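(* Fix an integer $p>1$. Let $\{x_i\}_{i\in\mathbb{Z}}$ be a strictly increasing sequence of real gridpoints (possibly non-uniform), let $x_{i+1/2}:=\frac{x_i+x_{i+1}}2$ and $I_i=[x_{i-1/2},x_{i+1/2})$, and let $\{v_i\}_{i\in\mathbb{Z}}$ be given real point-values. Let $\sum_k f_k(x)\mathbf{1}_{I_k}(x)$, with $\deg f_k\le p-1$, be the $p$-th order ENO interpolant of these point-values, and let $v^-_{i+1/2}:=f_i(x_{i+1/2})$ and $v^+_{i+1/2}:=f_{i+1}(x_{i+1/2})$. Then at every interface $x_{i+1/2}$, $i\in\mathbb{Z}$: \[ \text{if } v_{i+1}-v_i\ge 0 \text{ then } v^+_{i+1/2}-v^-_{i+1/2}\ge 0;\qquad \text{if } v_{i+1}-v_i\le 0 \text{ then } v^+_{i+1/2}-v^-_{i+1/2}\le 0 . \] In particular, if $v_{i+1}=v_i$ then $v^+_{i+1/2}=v^-_{i+1/2}$. Moreover, there is a constant $\mathsf{c}_p$, depending only on $p$ and on the mesh ratios $|x_{j+1}-x_j|/|x_j-x_{j-1}|$ of neighboring grid cells (and not on the point-values), such that, whenever $v_{i+1}\neq v_i$, \[ 0\le \frac{v^+_{i+1/2}-v^-_{i+1/2}}{v_{i+1}-v_i}\le \mathsf{c}_p . \]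
   Context: For integers $k$ and $j\ge0$, $v[x_k,\dots,x_{k+j}]$ denotes the usual Newton divided difference: $v[x_k]=v_k$ and $v[x_k,\dots,x_{k+j}]=\frac{v[x_{k+1},\dots,x_{k+j}]-v[x_k,\dots,x_{k+j-1}]}{x_{k+j}-x_k}$. $p$-th order ENO interpolation at gridpoint $x_i$: set $\ell_1=0$. For $j=1,\dots,p-1$: if $|v[x_{i+\ell_j-1},\dots,x_{i+\ell_j+j-1}]|<|v[x_{i+\ell_j},\dots,x_{i+\ell_j+j}]|$, set $\ell_{j+1}=\ell_j-1$; otherwise set $\ell_{j+1}=\ell_j$. Let $f_i$ be the polynomial of degree at most $p-1$ interpolating the values $v_k$ at the $p$ points $x_{i+\ell_p},\dots,x_{i+\ell_p+p-1}$. (The integer offsets $\ell_j\le 0$ depend on $i$ and the data.) Dependence of $\mathsf{c}_p$: at the interface $x_{i+1/2}$ the constant may depend on the ratios $|x_{j+1}-x_j|/|x_j-x_{j-1}|$ of the mesh, but on nothing else besides $p$. *)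

theory Defs
  imports Complex_Main "HOL-Computational_Algebra.Polynomial"
begin

(* divided_diff x v k j is the j-th order divided difference v[x_k, ..., x_(k+j)]. *)
primrec divided_diff :: "(int \<Rightarrow> real) \<Rightarrow> (int \<Rightarrow> real) \<Rightarrow> int \<Rightarrow> nat \<Rightarrow> real" where
  "divided_diff x v k 0 = v k"
| "divided_diff x v k (Suc j) =
     (divided_diff x v (k + 1) j - divided_diff x v k j) / (x (k + int (Suc j)) - x k)"

(* eno_offset x v i j is l_j, for j \<ge> 1; index 0 is not used and has a dummy value.
   The step from l_j to l_(j+1) is stated below with j = Suc n. *)
fun eno_offset :: "(int \<Rightarrow> real) \<Rightarrow> (int \<Rightarrow> real) \<Rightarrow> int \<Rightarrow> nat \<Rightarrow> int" where
  "eno_offset x v i 0 = 0"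
| "eno_offset x v i (Suc 0) = 0"
| "eno_offset x v i (Suc (Suc n)) =
     (let l = eno_offset x v i (Suc n) in
        if \<bar>divided_diff x v (i + l - 1) (Suc n)\<bar> < \<bar>divided_diff x v (i + l) (Suc n)\<bar>
        then l - 1 else l)"

(* The interpolant of v at the n points x_k, ..., x_(k+n-1); well defined for n \<ge> 1,
   see interp_poly_ex1. *)
definition interp_poly :: "(int \<Rightarrow> real) \<Rightarrow> (int \<Rightarrow> real) \<Rightarrow> int \<Rightarrow> nat \<Rightarrow> real poly" where
  "interp_poly x v k n =
     (THE q. degree q \<le> n - 1 \<and> (\<forall>m\<in>{k..<k + int n}. poly q (x m) = v m))"

definition eno_poly :: "nat \<Rightarrow> (int \<Rightarrow> real) \<Rightarrow> (int \<Rightarrow> real) \<Rightarrow> int \<Rightarrow> real poly" where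
  "eno_poly p x v i = interp_poly x v (i + eno_offset x v i p) p"

(* interface_pt x i is x_(i+1/2). *)
definition interface_pt :: "(int \<Rightarrow> real) \<Rightarrow> int \<Rightarrow> real" where
  "interface_pt x i = (x i + x (i + 1)) / 2"

(* The reconstruction is the piecewise polynomial equal to eno_poly p x v k on the cell
   {interface_pt x (k - 1)..<interface_pt x k}.
   eno_minus and eno_plus are its one-sided values v^- and v^+ at interface_pt x i. *)
definition eno_minus :: "nat \<Rightarrow> (int \<Rightarrow> real) \<Rightarrow> (int \<Rightarrow> real) \<Rightarrow> int \<Rightarrow> real" where
  "eno_minus p x v i = poly (eno_poly p x v i) (interface_pt x i)"

definition eno_plus :: "nat \<Rightarrow> (int \<Rightarrow> real) \<Rightarrow> (int \<Rightarrow> real) \<Rightarrow> int \<Rightarrow> real" where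
  "eno_plus p x v i = poly (eno_poly p x v (i + 1)) (interface_pt x i)"

definition mesh_ratio :: "(int \<Rightarrow> real) \<Rightarrow> int \<Rightarrow> real" where
  "mesh_ratio x j = \<bar>x (j + 1) - x j\<bar> / \<bar>x j - x (j - 1)\<bar>"

lemma interpolation_exists:
  fixes g :: "real \<Rightarrow> real"
  assumes "finite A"
  shows "\<exists>q. degree q \<le> card A - 1 \<and> (\<forall>a\<in>A. poly q a = g a)"
  using assms
proof (induction A rule: finite_induct)
  case empty
  show ?case by (intro exI[of _ 0]) simp
next
  case (insert b A)
  then obtain q where q: "degree q \<le> card A - 1" "\<forall>a\<in>A. poly q a = g a" by blast
  define w where "w = (\<Prod>a\<in>A. [:- a, 1:])"
  have dw: "degree w \<le> card A"
    using degree_prod_sum_le[OF insert.hyps(1), of "\<lambda>a. [:- a, 1:]"] by (simp add: w_def)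
  have wA: "poly w a = 0" if "a \<in> A" for a
    using that insert.hyps(1) by (auto simp: w_def poly_prod)
  have wb: "poly w b \<noteq> 0"
    using insert.hyps by (auto simp: w_def poly_prod)
  define r where "r = q + smult ((g b - poly q b) / poly w b) w"
  have "degree r \<le> card A"
    unfolding r_def using q(1) dw by (intro degree_add_le order.trans[OF degree_smult_le]) auto
  moreover have "\<forall>a\<in>insert b A. poly r a = g a"
    using q(2) wA wb by (auto simp: r_def)
  ultimately show ?case using insert.hyps by (intro exI[of _ r]) simp
qed

lemma interp_poly_ex1:
  assumes "strict_mono x" "n \<ge> 1"
  shows "\<exists>!q. degree q \<le> n - 1 \<and> (\<forall>m\<in>{k..<k + int n}. poly q (x m) = (v m :: real))"
proof -
  define A where "A = x ` {k..<k + int n}"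
  have inj: "inj x" using assms(1) by (rule strict_mono_imp_inj_on)
  have card: "card A = n"
    unfolding A_def using inj by (simp add: card_image inj_on_subset)
  obtain q where q: "degree q \<le> n - 1" "\<forall>a\<in>A. poly q a = (v \<circ> inv x) a"
    using interpolation_exists[of A "v \<circ> inv x"] card by (auto simp: A_def)
  show ?thesis
  proof (rule ex1I[of _ q])
    show "degree q \<le> n - 1 \<and> (\<forall>m\<in>{k..<k + int n}. poly q (x m) = v m)"
      using q inj by (auto simp: A_def)
  next
    fix r assume r: "degree r \<le> n - 1 \<and> (\<forall>m\<in>{k..<k + int n}. poly r (x m) = v m)"
    show "r = q"
      by (rule poly_eqI_degree[of A]) (use q r inj card assms(2) in \<open>auto simp: A_def\<close>)
  qed
qed

end

theory Submission
  imports Defs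
begin

text \<open>
  Both one-sided values at \<open>x\<^bsub>i+1/2\<^esub>\<close> come from interpolants on runs of \<open>p\<close> consecutive gridpoints,
  and the run chosen at \<open>x\<^sub>i\<close> never starts to the right of the one chosen at \<open>x\<^bsub>i+1\<^esub>\<close>.
  Moving the run one gridpoint at a time writes the jump as a telescoping sum
  over the starting points \<open>r\<close> that lie between the two choices, with summands
  \[
    v[x_r,\dots,x_{r+p}]\,(x_{r+p}-x_r)\prod_{m=r+1}^{r+p-1}(x_{i+1/2}-x_m)
  \]
  (\<open>interp_poly_shift\<close>, \<open>eno_jump\<close>). The sign of the product alternates with \<open>r\<close>, because it
  counts the gridpoints to the right of the interface. What makes ENO special is
  that the divided differences in this sum alternate as well and in step with the product, so that
  no summand has the sign opposite to that of \<open>v\<^bsub>i+1\<^esub> - v\<^sub>i\<close>.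

  The alternation is an induction on the order (\<open>eno_divided_diff_sign\<close>). A divided difference of the
  next order is a difference of two neighbors, up to a positive factor. If both neighbors lie
  between the two choices, they have opposite signs and reinforce each other. If only one does, the
  ENO selection guarantees that the other one is not larger in modulus and hence cannot overturn the
  sign (\<open>eno_window_step\<close>).

  The same dichotomy shows that each order costs at most a factor \<open>2\<close> and a division by a stencil
  width (\<open>eno_divided_diff_bound\<close>). Every stencil that occurs contains the cell
  \<open>[x\<^sub>i, x\<^bsub>i+1\<^esub>]\<close>, so the jump is in modulus at most \<open>p 2\<^bsup>p-1\<^esup> (H/h)\<^bsup>p\<^esup> |v\<^bsub>i+1\<^esub> - v\<^sub>i|\<close>, where
  \<open>h\<close> is the length of that cell and \<open>H = x\<^bsub>i+p\<^esub> - x\<^bsub>i+1-p\<^esub>\<close>. The quotient \<open>H/h\<close> is a function of the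
  mesh ratios alone.
\<close>

section \<open>Interpolants and divided differences\<close>

lemma interp_poly:
  assumes "strict_mono x" "n \<ge> 1"
  shows "degree (interp_poly x v k n) \<le> n - 1"
    and "\<And>m. k \<le> m \<Longrightarrow> m < k + int n \<Longrightarrow> poly (interp_poly x v k n) (x m) = v m"
  using theI'[OF interp_poly_ex1[OF assms, of k v]]
  unfolding interp_poly_def[symmetric] by auto

lemma interp_poly_eqI:
  assumes "strict_mono x" "n \<ge> 1" "degree q \<le> n - 1"
    and "\<And>m. k \<le> m \<Longrightarrow> m < k + int n \<Longrightarrow> poly q (x m) = v m"
  shows "interp_poly x v k n = q"
  using interp_poly_ex1[OF assms(1,2), of k v] interp_poly(1)[OF assms(1,2), of v k]
    interp_poly(2)[OF assms(1,2), of k] assms(3,4)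
  by auto

text \<open>Neville's recursion mirrors the recursion that defines the divided differences, and so
  identifies these as leading coefficients.\<close>

lemma interp_poly_Neville:
  assumes x: "strict_mono x" and "n \<ge> 1"
  shows "interp_poly x v k (Suc n) =
    smult (1 / (x (k + int n) - x k))
      ([:- x k, 1:] * interp_poly x v (k + 1) n - [:- x (k + int n), 1:] * interp_poly x v k n)"
    (is "_ = smult ?c (?A * ?P - ?B * ?Q)")
proof (rule interp_poly_eqI[OF x])
  note P = interp_poly[OF x \<open>n \<ge> 1\<close>]
  have "degree (?A * ?P) \<le> Suc (n - 1)" "degree (?B * ?Q) \<le> Suc (n - 1)"
    using P(1)[of v "k + 1"] P(1)[of v k]
    by (auto intro!: order.trans[OF degree_mult_le] simp del: mult_pCons_left)
  then show "degree (smult ?c (?A * ?P - ?B * ?Q)) \<le> Suc n - 1"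
    using \<open>n \<ge> 1\<close> by (intro order.trans[OF degree_smult_le] degree_diff_le) auto
next
  fix m assume m: "k \<le> m" "m < k + int (Suc n)"
  note P = interp_poly(2)[OF x \<open>n \<ge> 1\<close>]
  have ne: "x (k + int n) \<noteq> x k"
    using strict_monoD[OF x, of k "k + int n"] \<open>n \<ge> 1\<close> by auto
  consider "m = k" | "m = k + int n" | "k + 1 \<le> m" "m < k + int n" using m by linarith
  then show "poly (smult ?c (?A * ?P - ?B * ?Q)) (x m) = v m"
  proof cases
    case 1
    have "poly ?Q (x k) = v k" using P[of k k] \<open>n \<ge> 1\<close> by auto
    then show ?thesis using 1 ne by (simp add: field_simps)
  next
    case 2
    have "poly ?P (x m) = v m" using P[of "k + 1" m] \<open>n \<ge> 1\<close> 2 by auto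
    then show ?thesis using 2 ne by (simp add: field_simps)
  next
    case 3
    have "poly ?P (x m) = v m" "poly ?Q (x m) = v m" using P[of "k + 1" m] P[of k m] 3 by auto
    then show ?thesis using ne by (simp add: field_simps)
  qed
qed simp

lemma coeff_interp_poly:
  assumes x: "strict_mono x"
  shows "coeff (interp_poly x v k (Suc n)) n = divided_diff x v k n"
proof (induction n arbitrary: k)
  case 0
  have "interp_poly x v k (Suc 0) = [:v k:]"
  proof (rule interp_poly_eqI[OF x])
    fix m assume "k \<le> m" "m < k + int (Suc 0)"
    then have "m = k" by simp
    then show "poly [:v k:] (x m) = v m" by simp
  qed simp_all
  then show ?case by simp
next
  case (Suc n)
  have top: "coeff ([:a, 1:] * interp_poly x v l (Suc n)) (Suc n) = divided_diff x v l n" for a l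
  proof -
    have "coeff (interp_poly x v l (Suc n)) (Suc n) = 0"
      using interp_poly(1)[OF x, of "Suc n" v l] by (intro coeff_eq_0) simp
    then show ?thesis using Suc.IH[of l] by simp
  qed
  show ?case
    by (subst interp_poly_Neville[OF x]) (simp_all only: coeff_smult coeff_diff top, simp_all)
qed

text \<open>The two interpolants agree at the \<open>n\<close> points which their stencils share, so their difference
  is its leading coefficient times the nodal polynomial of these points.\<close>

lemma interp_poly_shift:
  assumes x: "strict_mono x"
  shows "interp_poly x v (k + 1) (Suc n) - interp_poly x v k (Suc n) =
    smult (divided_diff x v k (Suc n) * (x (k + int (Suc n)) - x k))
      (\<Prod>m\<in>{k + 1..<k + 1 + int n}. [:- x m, 1:])" (is "?P - ?Q = smult ?c ?w")
proof -
  define A where "A = x ` {k + 1..<k + 1 + int n}"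
  have inj: "inj x" using x by (rule strict_mono_imp_inj_on)
  have card: "card A = n" unfolding A_def using inj by (simp add: card_image inj_on_subset)
  have deg: "degree ?w = n" by (simp add: degree_prod_sum_eq)
  have "lead_coeff ?w = 1" by (simp add: lead_coeff_prod)
  then have w: "coeff ?w n = 1" unfolding deg .
  have ne: "x (k + int (Suc n)) \<noteq> x k"
    using strict_monoD[OF x, of k "k + int (Suc n)"] by auto
  show ?thesis
  proof (rule poly_eqI_degree_lead_coeff[where n = n and A = A])
    show "coeff (?P - ?Q) n = coeff (smult ?c ?w) n"
      using ne w by (simp add: coeff_interp_poly[OF x])
    show "degree (?P - ?Q) \<le> n"
      using interp_poly(1)[OF x, of "Suc n"] by (intro degree_diff_le) simp_all
    show "degree (smult ?c ?w) \<le> n" using deg by (simp add: order.trans[OF degree_smult_le])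
    show "card A \<ge> n" using card by simp
  next
    fix z assume "z \<in> A"
    then obtain m where m: "z = x m" "m \<in> {k + 1..<k + 1 + int n}" by (auto simp: A_def)
    have "poly ?P z = v m" "poly ?Q z = v m"
      using m interp_poly(2)[OF x, of "Suc n"] by auto
    moreover have "poly ?w z = 0" using m by (auto simp: poly_prod)
    ultimately show "poly (?P - ?Q) z = poly (smult ?c ?w) z" by simp
  qed
qed

section \<open>The stencils chosen from the two sides of an interface\<close>

text \<open>The index of the leftmost gridpoint in the stencil of \<open>n + 1\<close> points selected at \<open>x\<^sub>i\<close>.
  Counting from \<open>n = 0\<close> turns the selection into a plain recursion (\<open>eno_left_Suc\<close>).\<close>

definition eno_left :: "(int \<Rightarrow> real) \<Rightarrow> (int \<Rightarrow> real) \<Rightarrow> int \<Rightarrow> nat \<Rightarrow> int" where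
  "eno_left x v i n = i + eno_offset x v i (Suc n)"

lemma eno_left_0 [simp]: "eno_left x v i 0 = i"
  by (simp add: eno_left_def)

lemma eno_left_Suc:
  "eno_left x v i (Suc n) =
    (if \<bar>divided_diff x v (eno_left x v i n - 1) (Suc n)\<bar> < \<bar>divided_diff x v (eno_left x v i n) (Suc n)\<bar>
     then eno_left x v i n - 1 else eno_left x v i n)"
  by (simp add: eno_left_def Let_def del: divided_diff.simps)

lemma eno_left_bounds: "i - int n \<le> eno_left x v i n" "eno_left x v i n \<le> i"
  by (induction n) (auto simp: eno_left_Suc simp del: divided_diff.simps)

text \<open>Two distinct left ends cannot cross in one step, and equal ones make the same decision
  from then on.\<close>

lemma eno_left_mono: "eno_left x v i n \<le> eno_left x v (i + 1) n"
proof (induction n)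
  case (Suc n)
  then show ?case
    by (cases "eno_left x v i n = eno_left x v (i + 1) n")
       (auto simp: eno_left_Suc simp del: divided_diff.simps)
qed simp

text \<open>The left ends of the stencils between the choices made at \<open>x\<^sub>i\<close> and at \<open>x\<^bsub>i+1\<^esub>\<close>. The right end
  is left out because a member \<open>r\<close> stands for the move from the stencil at \<open>r\<close> to the one at
  \<open>r + 1\<close>.\<close>

definition eno_window :: "(int \<Rightarrow> real) \<Rightarrow> (int \<Rightarrow> real) \<Rightarrow> int \<Rightarrow> nat \<Rightarrow> int set" where
  "eno_window x v i n = {eno_left x v i n..<eno_left x v (i + 1) n}"

lemma eno_windowD:
  assumes "r \<in> eno_window x v i n"
  shows "i - int n \<le> r" "r \<le> i"
  using assms eno_left_bounds[where x = x and v = v and n = n and i = i]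
    eno_left_bounds[where x = x and v = v and n = n and i = "i + 1"]
  by (auto simp: eno_window_def)

lemma card_eno_window: "card (eno_window x v i n) \<le> Suc n"
proof -
  have "eno_window x v i n \<subseteq> {i - int n..i}" using eno_windowD by auto
  from card_mono[OF _ this] show ?thesis by simp
qed

text \<open>A window gains a left end only if the selection at \<open>x\<^sub>i\<close> moves left, and keeps its last
  left end only if the selection at \<open>x\<^bsub>i+1\<^esub>\<close> does not move left. Either decision compares
  exactly the two divided differences in question.\<close>

lemma eno_window_step:
  fixes x v i n
  defines "W \<equiv> eno_window x v i n" and "D \<equiv> \<lambda>r. divided_diff x v r (Suc n)"
  assumes "r \<in> eno_window x v i (Suc n)"
  obtains "r \<in> W" "r + 1 \<in> W"
    | "r + 1 \<in> W" "\<bar>D r\<bar> \<le> \<bar>D (r + 1)\<bar>"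
    | "r \<in> W" "\<bar>D (r + 1)\<bar> \<le> \<bar>D r\<bar>"
proof -
  define a b where "a = eno_left x v i n" and "b = eno_left x v (i + 1) n"
  define a' b' where "a' = eno_left x v i (Suc n)" and "b' = eno_left x v (i + 1) (Suc n)"
  have a': "a' = (if \<bar>D (a - 1)\<bar> < \<bar>D a\<bar> then a - 1 else a)"
    unfolding a'_def a_def D_def by (rule eno_left_Suc)
  have b': "b' = (if \<bar>D (b - 1)\<bar> < \<bar>D b\<bar> then b - 1 else b)"
    unfolding b'_def b_def D_def by (rule eno_left_Suc)
  have "a \<le> b" unfolding a_def b_def by (rule eno_left_mono)
  have W: "s \<in> W \<longleftrightarrow> a \<le> s \<and> s < b" for s
    by (auto simp: W_def eno_window_def a_def b_def)
  have r: "a' \<le> r" "r < b'" using assms(3) by (auto simp: eno_window_def a'_def b'_def)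
  \<comment> \<open>Selections that coincide at one order coincide at the next, which leaves no room for \<open>r\<close>.\<close>
  then have "a < b" using \<open>a \<le> b\<close> a' b' by (cases "a = b") (auto split: if_splits)
  consider "r < a" | "r + 1 = b" "a \<le> r" | "a \<le> r" "r + 1 < b"
    using r b' by (auto split: if_splits) linarith+
  then show thesis
  proof cases
    case 1
    then have "r = a - 1" "\<bar>D (a - 1)\<bar> < \<bar>D a\<bar>" using r(1) a' by (auto split: if_splits)
    then show thesis using that(2) W \<open>a < b\<close> by auto
  next
    case 2
    then have "\<not> \<bar>D (b - 1)\<bar> < \<bar>D b\<bar>" "r = b - 1" using r(2) b' by (auto split: if_splits)
    moreover from this have "r \<in> W" unfolding W using \<open>a \<le> r\<close> by linarith
    ultimately show thesis by (intro that(3)) auto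
  next
    case 3
    then have "r \<in> W" "r + 1 \<in> W" unfolding W using \<open>a < b\<close> by linarith+
    then show thesis by (rule that(1))
  qed
qed

section \<open>Signs and sizes of the divided differences\<close>

text \<open>The factor \<open>\<sigma>\<close> treats both signs of \<open>v\<^bsub>i+1\<^esub> - v\<^sub>i\<close> at once. The exponent is the number
  of interior points \<open>x\<^bsub>r+1\<^esub>, \<dots>, x\<^bsub>r+n\<^esub>\<close> to the right of the interface, which matches
  \<open>prod_nodes_sign\<close>.\<close>

lemma eno_divided_diff_sign:
  assumes x: "strict_mono x" and \<sigma>: "0 \<le> \<sigma> * (v (i + 1) - v i)"
    and "r \<in> eno_window x v i n"
  shows "0 \<le> \<sigma> * (-1) powi (r + int n - i) * divided_diff x v r (Suc n)"
  using assms(3)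
proof (induction n arbitrary: r)
  case 0
  then have "r = i" by (auto simp: eno_window_def)
  moreover have "x i < x (i + 1)" using strict_monoD[OF x, of i "i + 1"] by simp
  ultimately show ?case using \<sigma> by (simp add: zero_le_mult_iff zero_le_divide_iff)
next
  case (Suc n)
  define D where "D = (\<lambda>r. divided_diff x v r (Suc n))"
  define \<tau> where "\<tau> = \<sigma> * (-1) powi (r + int (Suc n) - i)"
  have \<tau>': "\<sigma> * (-1) powi (r + int n - i) = - \<tau>"
    using power_int_add_1[of "-1 :: real" "r + int n - i"] by (simp add: \<tau>_def algebra_simps)
  have D0: "0 \<le> - (\<tau> * D r)" if "r \<in> eno_window x v i n"
    using Suc.IH[OF that] unfolding \<tau>' D_def by simp
  have D1: "0 \<le> \<tau> * D (r + 1)" if "r + 1 \<in> eno_window x v i n"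
    using Suc.IH[OF that] unfolding \<tau>_def D_def by (simp add: algebra_simps)
  have "0 \<le> \<tau> * D (r + 1) - \<tau> * D r"
    using Suc.prems
  proof (cases rule: eno_window_step)
    case 1
    then show ?thesis using D0 D1 by simp
  next
    case 2
    then have "\<bar>\<tau> * D r\<bar> \<le> \<bar>\<tau> * D (r + 1)\<bar>"
      unfolding D_def abs_mult by (intro mult_left_mono) auto
    then show ?thesis using D1 2 by linarith
  next
    case 3
    then have "\<bar>\<tau> * D (r + 1)\<bar> \<le> \<bar>\<tau> * D r\<bar>"
      unfolding D_def abs_mult by (intro mult_left_mono) auto
    then show ?thesis using D0 3 by linarith
  qed
  moreover have "x r < x (r + int (Suc (Suc n)))" using strict_monoD[OF x] by simp
  moreover have "divided_diff x v r (Suc (Suc n)) =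
      (D (r + 1) - D r) / (x (r + int (Suc (Suc n))) - x r)"
    unfolding D_def by (rule divided_diff.simps)
  ultimately show ?case
    unfolding \<tau>_def[symmetric] by (simp add: right_diff_distrib)
qed

text \<open>By \<open>eno_window_step\<close>, a neighbor outside the window is no larger in modulus than the one inside,
  so the induction hypothesis bounds both. Their difference costs the factor \<open>2\<close>.\<close>

lemma eno_divided_diff_bound:
  assumes x: "strict_mono x" and "r \<in> eno_window x v i n"
  shows "\<bar>divided_diff x v r (Suc n)\<bar> \<le> 2 ^ n * \<bar>v (i + 1) - v i\<bar> / (x (i + 1) - x i) ^ Suc n"
  using assms(2)
proof (induction n arbitrary: r)
  case 0
  then have "r = i" by (auto simp: eno_window_def)
  moreover have "x i < x (i + 1)" using strict_monoD[OF x, of i "i + 1"] by simp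
  ultimately show ?case by simp
next
  case (Suc n)
  define D where "D = (\<lambda>r. divided_diff x v r (Suc n))"
  define h where "h = x (i + 1) - x i"
  define B where "B = 2 ^ n * \<bar>v (i + 1) - v i\<bar> / h ^ Suc n"
  define \<Delta> where "\<Delta> = x (r + int (Suc (Suc n))) - x r"
  have "h > 0" using strict_monoD[OF x, of i "i + 1"] by (simp add: h_def)
  have IH: "\<bar>D s\<bar> \<le> B" if "s \<in> eno_window x v i n" for s
    using Suc.IH[OF that] unfolding D_def B_def h_def .
  have "\<bar>D r\<bar> \<le> B \<and> \<bar>D (r + 1)\<bar> \<le> B"
    using Suc.prems
  proof (cases rule: eno_window_step)
    case 1
    then show ?thesis using IH by blast
  next
    case 2
    then show ?thesis using IH[of "r + 1"] unfolding D_def by linarith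
  next
    case 3
    then show ?thesis using IH[of r] unfolding D_def by linarith
  qed
  then have "\<bar>D (r + 1) - D r\<bar> \<le> 2 * B" by linarith
  moreover have "h \<le> \<Delta>"
  proof -
    have "x (i + 1) \<le> x (r + int (Suc (Suc n)))" "x r \<le> x i"
      using eno_windowD[OF Suc.prems] by (auto simp: strict_mono_less_eq[OF x])
    then show ?thesis by (simp add: h_def \<Delta>_def)
  qed
  ultimately have "\<bar>D (r + 1) - D r\<bar> / \<Delta> \<le> 2 * B / h"
    using \<open>h > 0\<close> by (intro frac_le) auto
  moreover have "\<bar>divided_diff x v r (Suc (Suc n))\<bar> = \<bar>D (r + 1) - D r\<bar> / \<Delta>"
    using \<open>h > 0\<close> \<open>h \<le> \<Delta>\<close> by (simp add: D_def \<Delta>_def abs_divide)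
  ultimately show ?case by (simp add: B_def h_def mult_ac del: divided_diff.simps)
qed

section \<open>The jump at an interface\<close>

lemma interface_pt_less:
  assumes "strict_mono x"
  shows "x i < interface_pt x i" "interface_pt x i < x (i + 1)"
  using strict_monoD[OF assms, of i "i + 1"] by (auto simp: interface_pt_def)

text \<open>The maximum lets the induction start at \<open>n = 0\<close>, before the run of points has reached
  the interface.\<close>

lemma prod_nodes_sign:
  fixes x :: "int \<Rightarrow> real"
  assumes x: "strict_mono x" and "x i < y" "y < x (i + 1)" and "r \<le> i"
  shows "0 < (-1) powi max 0 (r + int n - i) * (\<Prod>m\<in>{r + 1..<r + 1 + int n}. y - x m)"
proof (induction n)
  case 0
  then show ?case using \<open>r \<le> i\<close> by simp
next
  case (Suc n)
  let ?w = "\<lambda>n. \<Prod>m\<in>{r + 1..<r + 1 + int n}. y - x m"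
  have "{r + 1..<r + 1 + int (Suc n)} = insert (r + 1 + int n) {r + 1..<r + 1 + int n}" by auto
  then have w: "?w (Suc n) = (y - x (r + 1 + int n)) * ?w n" by simp
  show ?case
  proof (cases "r + 1 + int n \<le> i")
    case True
    then have "x (r + 1 + int n) \<le> x i" by (simp add: strict_mono_less_eq[OF x])
    then have "0 < y - x (r + 1 + int n)" using \<open>x i < y\<close> by simp
    moreover have "0 < ?w n" using Suc.IH True by simp
    ultimately show ?thesis using True unfolding w by simp
  next
    case False
    then have "x (i + 1) \<le> x (r + 1 + int n)" by (simp add: strict_mono_less_eq[OF x])
    then have neg: "0 < x (r + 1 + int n) - y" using \<open>y < x (i + 1)\<close> by simp
    have "max 0 (r + int (Suc n) - i) = max 0 (r + int n - i) + 1" using False by simp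
    then have "(-1 :: real) powi max 0 (r + int (Suc n) - i) = - ((-1) powi max 0 (r + int n - i))"
      by (simp add: power_int_add_1)
    then have "(-1) powi max 0 (r + int (Suc n) - i) * ?w (Suc n) =
        (x (r + 1 + int n) - y) * ((-1) powi max 0 (r + int n - i) * ?w n)"
      unfolding w by (simp add: algebra_simps)
    then show ?thesis using mult_pos_pos[OF neg Suc.IH] by simp
  qed
qed

text \<open>The difference, at the interface, of the interpolants whose stencils start at \<open>r + 1\<close>
  and at \<open>r\<close>, in the form given by \<open>interp_poly_shift\<close>.\<close>

definition jump_term :: "(int \<Rightarrow> real) \<Rightarrow> (int \<Rightarrow> real) \<Rightarrow> int \<Rightarrow> nat \<Rightarrow> int \<Rightarrow> real" where
  "jump_term x v i n r = divided_diff x v r (Suc n) * (x (r + int (Suc n)) - x r) *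
     (\<Prod>m\<in>{r + 1..<r + 1 + int n}. interface_pt x i - x m)"

lemma eno_jump:
  assumes x: "strict_mono x"
  shows "eno_plus (Suc n) x v i - eno_minus (Suc n) x v i = sum (jump_term x v i n) (eno_window x v i n)"
proof -
  define P where "P k = poly (interp_poly x v k (Suc n)) (interface_pt x i)" for k
  have shift: "P (k + 1) - P k = jump_term x v i n k" for k
    unfolding P_def jump_term_def poly_diff[symmetric] interp_poly_shift[OF x]
    by (simp add: poly_prod algebra_simps)
  have "P b - P a = sum (jump_term x v i n) {a..<b}" if "a \<le> b" for a b
    using that
  proof (induction b rule: int_ge_induct)
    case (step b)
    then have "{a..<b + 1} = insert b {a..<b}" by auto
    then show ?case using step.IH shift[of b] by simp
  qed simp
  from this[OF eno_left_mono[of x v i n]] show ?thesis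
    by (simp add: eno_window_def eno_plus_def eno_minus_def eno_poly_def P_def eno_left_def)
qed

text \<open>The signs \<open>(-1)\<^bsup>r+n-i\<^esup>\<close> of the divided difference and of the nodal product cancel in each
  summand.\<close>

theorem eno_jump_sign:
  assumes x: "strict_mono x" and \<sigma>: "0 \<le> \<sigma> * (v (i + 1) - v i)"
  shows "0 \<le> \<sigma> * (eno_plus (Suc n) x v i - eno_minus (Suc n) x v i)"
proof -
  have "0 \<le> \<sigma> * jump_term x v i n r" if r: "r \<in> eno_window x v i n" for r
  proof -
    note r' = eno_windowD[OF r]
    define s where "s = ((-1) powi (r + int n - i) :: real)"
    define w where "w = (\<Prod>m\<in>{r + 1..<r + 1 + int n}. interface_pt x i - x m)"
    have "0 < s * w"
      using prod_nodes_sign[OF x interface_pt_less[OF x] r'(2), of n] r'(1) by (simp add: s_def w_def)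
    moreover have "0 \<le> \<sigma> * s * divided_diff x v r (Suc n)"
      using eno_divided_diff_sign[OF x \<sigma> r] by (simp only: s_def)
    moreover have "x r < x (r + int (Suc n))" using strict_monoD[OF x] by simp
    ultimately have "0 \<le> (\<sigma> * s * divided_diff x v r (Suc n)) * (x (r + int (Suc n)) - x r) * (s * w)"
      by (auto intro: mult_nonneg_nonneg[OF mult_nonneg_nonneg] simp del: divided_diff.simps)
    also have "\<dots> = (s * s) * (\<sigma> * jump_term x v i n r)"
      unfolding jump_term_def w_def[symmetric] by (simp only: mult_ac)
    also have "s * s = 1" by (simp add: s_def flip: power_int_mult_distrib)
    finally show ?thesis by simp
  qed
  then show ?thesis
    unfolding eno_jump[OF x] sum_distrib_left by (rule sum_nonneg)
qed

text \<open>All gridpoints that enter the summands lie in \<open>[x\<^bsub>i-n\<^esub>, x\<^bsub>i+n+1\<^esub>]\<close>, so each of the \<open>n + 1\<close>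
  distances that multiply a divided difference is at most the length \<open>H\<close> of this interval.\<close>

theorem eno_jump_bound:
  fixes x v i n
  defines "h \<equiv> x (i + 1) - x i" and "H \<equiv> x (i + int (Suc n)) - x (i - int n)"
  assumes x: "strict_mono x"
  shows "\<bar>eno_plus (Suc n) x v i - eno_minus (Suc n) x v i\<bar>
    \<le> real (Suc n) * 2 ^ n * (H / h) ^ Suc n * \<bar>v (i + 1) - v i\<bar>"
proof -
  have "h > 0" using strict_monoD[OF x, of i "i + 1"] by (simp add: h_def)
  have "H \<ge> 0" by (simp add: H_def strict_mono_less_eq[OF x])
  define B where "B = 2 ^ n * (H / h) ^ Suc n * \<bar>v (i + 1) - v i\<bar>"
  have "\<bar>jump_term x v i n r\<bar> \<le> B" if r: "r \<in> eno_window x v i n" for r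
  proof -
    note r' = eno_windowD[OF r]
    define w where "w = (\<Prod>m\<in>{r + 1..<r + 1 + int n}. interface_pt x i - x m)"
    have node: "\<bar>interface_pt x i - x m\<bar> \<le> H" if "m \<in> {r + 1..<r + 1 + int n}" for m
    proof -
      have "x (i - int n) \<le> x m" "x m \<le> x (i + int (Suc n))"
        "x (i - int n) \<le> x i" "x (i + 1) \<le> x (i + int (Suc n))"
        using that r' by (auto simp: strict_mono_less_eq[OF x])
      then show ?thesis using interface_pt_less[OF x, of i] by (auto simp: H_def)
    qed
    have "\<bar>w\<bar> \<le> (\<Prod>m\<in>{r + 1..<r + 1 + int n}. H)"
      unfolding w_def abs_prod by (intro prod_mono) (use node in auto)
    then have w: "\<bar>w\<bar> \<le> H ^ n" by simp
    have "x r < x (r + int (Suc n))" "x (i - int n) \<le> x r" "x (r + int (Suc n)) \<le> x (i + int (Suc n))"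
      using r' by (auto simp: strict_mono_less_eq[OF x] strict_mono_less[OF x])
    then have \<Delta>: "\<bar>x (r + int (Suc n)) - x r\<bar> \<le> H" by (simp add: H_def)
    have "\<bar>jump_term x v i n r\<bar> =
        \<bar>divided_diff x v r (Suc n)\<bar> * \<bar>x (r + int (Suc n)) - x r\<bar> * \<bar>w\<bar>"
      unfolding jump_term_def w_def by (simp only: abs_mult)
    also have "\<dots> \<le> (2 ^ n * \<bar>v (i + 1) - v i\<bar> / h ^ Suc n) * H * H ^ n"
      using eno_divided_diff_bound[OF x r] w \<Delta> \<open>h > 0\<close> \<open>H \<ge> 0\<close>
      by (intro mult_mono) (auto simp: h_def simp del: divided_diff.simps)
    also have "\<dots> = B" by (simp add: B_def power_divide)
    finally show ?thesis .
  qed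
  then have "\<bar>sum (jump_term x v i n) (eno_window x v i n)\<bar> \<le> real (card (eno_window x v i n)) * B"
    by (intro order.trans[OF sum_abs] sum_bounded_above)
  also have "\<dots> \<le> real (Suc n) * B"
    using card_eno_window[of x v i n] \<open>h > 0\<close> \<open>H \<ge> 0\<close>
    by (intro mult_right_mono) (simp_all add: B_def del: of_nat_Suc)
  finally show ?thesis unfolding eno_jump[OF x] B_def by (simp add: mult.assoc)
qed

section \<open>Recovering relative mesh widths from mesh ratios\<close>

text \<open>Let cell \<open>j\<close> be the interval from gridpoint \<open>j\<close> to gridpoint \<open>j + 1\<close>. If \<open>\<rho> j\<close>
  is the ratio of the lengths of the cells \<open>j\<close> and \<open>j - 1\<close>, the two sums collect the lengths of the cells \<open>0, \<dots>, n\<close> and \<open>-1, \<dots>, -n\<close> in units of the length of cell \<open>0\<close>.\<close>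

definition relative_width :: "nat \<Rightarrow> (int \<Rightarrow> real) \<Rightarrow> real" where
  "relative_width n \<rho> =
     (\<Sum>j<Suc n. \<Prod>k<j. \<rho> (int k + 1)) + (\<Sum>j<n. \<Prod>k<Suc j. inverse (\<rho> (- int k)))"

lemma relative_width_mesh_ratio:
  assumes x: "strict_mono x"
  shows "relative_width n (\<lambda>j. mesh_ratio x (i + j)) =
    (x (i + int (Suc n)) - x (i - int n)) / (x (i + 1) - x i)"
proof -
  define h where "h j = x (i + j + 1) - x (i + j)" for j
  have h: "h j > 0" for j using strict_monoD[OF x, of "i + j" "i + j + 1"] by (simp add: h_def)
  have ratio: "mesh_ratio x (i + j) = h j / h (j - 1)" for j
    using h[of j] h[of "j - 1"] by (simp add: mesh_ratio_def h_def algebra_simps)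
  have right: "(\<Prod>k<j. mesh_ratio x (i + (int k + 1))) = h (int j) / h 0" for j
  proof (induction j)
    case 0
    then show ?case using h[of 0] by simp
  next
    case (Suc j)
    then show ?case using h[of "int j"] unfolding prod.lessThan_Suc ratio
      by (simp add: algebra_simps)
  qed
  have left: "(\<Prod>k<j. inverse (mesh_ratio x (i + - int k))) = h (- int j) / h 0" for j
  proof (induction j)
    case 0
    then show ?case using h[of 0] by simp
  next
    case (Suc j)
    have neg: "- int (Suc j) = - int j - 1" by simp
    show ?case
      unfolding prod.lessThan_Suc Suc.IH unfolding ratio neg using h[of "- int j"] by simp
  qed
  have sum_right: "(\<Sum>j<m. h (int j)) = x (i + int m) - x i" for m
    by (induction m) (simp_all add: h_def algebra_simps)
  have sum_left: "(\<Sum>j<m. h (- int (Suc j))) = x i - x (i - int m)" for m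
    by (induction m) (simp_all add: h_def algebra_simps)
  have "relative_width n (\<lambda>j. mesh_ratio x (i + j)) =
      ((\<Sum>j<Suc n. h (int j)) + (\<Sum>j<n. h (- int (Suc j)))) / h 0"
    unfolding relative_width_def right left by (simp only: sum_divide_distrib add_divide_distrib)
  then show ?thesis unfolding sum_right sum_left by (simp add: h_def)
qed

section \<open>The sign property and the bound on the jump\<close>

theorem theorem1p2:
  fixes p :: nat
  assumes "p > 1"
  shows "(\<forall>(x :: int \<Rightarrow> real) (v :: int \<Rightarrow> real) (i :: int). strict_mono x \<longrightarrow>
            (v (i + 1) - v i \<ge> 0 \<longrightarrow> eno_plus p x v i - eno_minus p x v i \<ge> 0) \<and>
            (v (i + 1) - v i \<le> 0 \<longrightarrow> eno_plus p x v i - eno_minus p x v i \<le> 0) \<and>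
            (v (i + 1) = v i \<longrightarrow> eno_plus p x v i = eno_minus p x v i))
       \<and> (\<exists>c :: (int \<Rightarrow> real) \<Rightarrow> real.
            \<forall>(x :: int \<Rightarrow> real) (v :: int \<Rightarrow> real) (i :: int).
              strict_mono x \<longrightarrow> v (i + 1) \<noteq> v i \<longrightarrow>
                0 \<le> (eno_plus p x v i - eno_minus p x v i) / (v (i + 1) - v i) \<and>
                (eno_plus p x v i - eno_minus p x v i) / (v (i + 1) - v i)
                  \<le> c (\<lambda>j. mesh_ratio x (i + j)))"
proof -
  from assms obtain n where p: "p = Suc n" by (cases p) auto
  define c where "c \<rho> = real (Suc n) * 2 ^ n * relative_width n \<rho> ^ Suc n" for \<rho>
  have pos: "eno_plus p x v i - eno_minus p x v i \<ge> 0"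
    if "strict_mono x" "v (i + 1) - v i \<ge> 0" for x v i
    using eno_jump_sign[of x 1 v i n] that p by simp
  have neg: "eno_plus p x v i - eno_minus p x v i \<le> 0"
    if "strict_mono x" "v (i + 1) - v i \<le> 0" for x v i
    using eno_jump_sign[of x "-1" v i n] that p by simp
  have "0 \<le> (eno_plus p x v i - eno_minus p x v i) / (v (i + 1) - v i) \<and>
      (eno_plus p x v i - eno_minus p x v i) / (v (i + 1) - v i) \<le> c (\<lambda>j. mesh_ratio x (i + j))"
    if x: "strict_mono x" and ne: "v (i + 1) \<noteq> v i" for x v i
  proof
    let ?J = "eno_plus p x v i - eno_minus p x v i" and ?d = "v (i + 1) - v i"
    show "0 \<le> ?J / ?d"
      using pos[OF x, of v i] neg[OF x, of v i] by (cases "?d \<ge> 0") (auto simp: zero_le_divide_iff)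
    have "\<bar>?J\<bar> \<le> c (\<lambda>j. mesh_ratio x (i + j)) * \<bar>?d\<bar>"
      using eno_jump_bound[OF x, of n v i] unfolding p c_def relative_width_mesh_ratio[OF x] .
    then have "\<bar>?J / ?d\<bar> \<le> c (\<lambda>j. mesh_ratio x (i + j))"
      using ne by (simp add: abs_divide divide_le_eq)
    then show "?J / ?d \<le> c (\<lambda>j. mesh_ratio x (i + j))" by linarith
  qed
  moreover have "eno_plus p x v i = eno_minus p x v i"
    if "strict_mono x" "v (i + 1) = v i" for x v i
    using pos[of x v i] neg[of x v i] that by simp
  ultimately show ?thesis using pos neg by blast
qed

end
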